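(* Let $A$ be an $n\times n$ complex matrix, let $\Sigma$ be a complex matrix with $n$ rows and orthonormal columns, and let $\Delta$ be a matrix whose columns are an orthonormal basis for the orthogonal complement of the column space of $\Sigma$ in $\mathbb{C}^n$. Then $$\det\left(\lambda I-\mathcal{R}(\lambda,\Sigma,A)\right)=\frac{\det(\lambda I-A)}{\det(\lambda I-\Delta^*A\Delta)}.$$
   Context: For a matrix $\Sigma$ with orthonormal columns and a square complex matrix $A$ with as many rows as $\Sigma$, the generalized isospectral reduction of $A$ with respect to $\Sigma$ is $\mathcal{R}(\lambda,\Sigma,A)=\lambda I-\left(\Sigma^*(\lambda I-A)^{-1}\Sigma\right)^{-1}$, a matrix of rational functions in the variable $\lambda$; $\Sigma^*$ is the conjugate transpose. *)

theory Defs
  imports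
    "Jordan_Normal_Form.Schur_Decomposition"
    "Jordan_Normal_Form.VS_Connect"
    "HOL-Computational_Algebra.Polynomial_Factorial"
begin

text \<open>
  The field of rational functions in one variable over the complex numbers is rendered as
  \<^typ>\<open>complex poly fract\<close>.
\<close>

definition ratfun_var :: "complex poly fract" where
  "ratfun_var = to_fract [:0, 1:]"

text \<open>A complex matrix, regarded as a matrix of constant rational functions.\<close>

definition ratfun_mat :: "complex mat \<Rightarrow> complex poly fract mat" where
  "ratfun_mat = map_mat (\<lambda>a. to_fract [:a:])"

definition orthonormal_cols :: "complex mat \<Rightarrow> bool" where
  "orthonormal_cols M \<longleftrightarrow>
     (\<forall>i < dim_col M. \<forall>j < dim_col M. col M i \<bullet>c col M j = (if i = j then 1 else 0))"

text \<open>
  The orthogonal complement with respect to the Hermitian inner product. (The constant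
  \<open>orthogonal_complement\<close> of the library uses the bilinear form without conjugation.)
\<close>

definition hermitian_complement :: "nat \<Rightarrow> complex vec set \<Rightarrow> complex vec set" where
  "hermitian_complement n W = {v \<in> carrier_vec n. \<forall>w \<in> W. v \<bullet>c w = 0}"

text \<open>
  The columns of \<open>M\<close> form an orthonormal basis of the subspace \<open>W\<close> of complex \<open>n\<close>-space.
  Orthonormality makes the columns distinct and linearly independent, so only spanning
  has to be added.
\<close>

definition orthonormal_basis_cols :: "nat \<Rightarrow> complex mat \<Rightarrow> complex vec set \<Rightarrow> bool" where
  "orthonormal_basis_cols n M W \<longleftrightarrow>
     dim_row M = n \<and> orthonormal_cols M \<and> vec_space.col_space n M = W"

text \<open>
  Inverse of a square matrix over a field. As \<open>mat_inverse\<close> returns \<open>None\<close> on singular matrices,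
  the value is unspecified for those.
\<close>

abbreviation inv_mat :: "'a :: field mat \<Rightarrow> 'a mat" where
  "inv_mat M \<equiv> the (mat_inverse M)"

definition isospectral_reduction :: "complex mat \<Rightarrow> complex mat \<Rightarrow> complex poly fract mat" where
  "isospectral_reduction S A =
     ratfun_var \<cdot>\<^sub>m 1\<^sub>m (dim_col S) -
     inv_mat (ratfun_mat (mat_adjoint S) *
              inv_mat (ratfun_var \<cdot>\<^sub>m 1\<^sub>m (dim_row A) - ratfun_mat A) *
              ratfun_mat S)"

end

theory Submission
  imports Defs "Subresultants.More_Homomorphisms"
begin

text \<open>
  Put \<open>B = \<lambda>I - A\<close>, \<open>C = B\<inverse>\<close>, and let \<open>U = (\<Sigma> | \<Delta>)\<close>, which is unitary. In block form,
  \<open>U\<^sup>* (C\<Sigma> | \<Delta>)\<close> is lower triangular with diagonal blocks \<open>\<Sigma>\<^sup>*C\<Sigma>\<close> and \<open>I\<close>, while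
  \<open>U\<^sup>* B (C\<Sigma> | \<Delta>) = U\<^sup>* (\<Sigma> | B\<Delta>)\<close> is upper triangular with diagonal blocks \<open>I\<close> and
  \<open>\<Delta>\<^sup>*B\<Delta>\<close>. Comparing determinants gives \<open>det B \<cdot> det (\<Sigma>\<^sup>*C\<Sigma>) = det (\<Delta>\<^sup>*B\<Delta>)\<close>.
  That \<open>U\<close> is square follows by taking traces in \<open>I - \<Sigma>\<Sigma>\<^sup>* = \<Delta>\<Delta>\<^sup>*\<close>.
\<close>

text \<open>The adjoints enter only through the four product relations, so arbitrary matrices
  \<open>S'\<close> and \<open>D'\<close> take their place. This makes the identity available over
  rational functions, where the adjoints are formed over the complex numbers and embedded
  afterwards. Below, \<open>V\<close> plays the role of the adjoint of U and \<open>W\<close> that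
  of the juxtaposition of \<open>C * S\<close> and \<open>D\<close>.\<close>

lemma det_compress_inverse:
  fixes B C S S' D D' :: "'a :: idom mat"
  assumes n: "n = k + m"
    and B: "B \<in> carrier_mat n n" and C: "C \<in> carrier_mat n n" and BC: "B * C = 1\<^sub>m n"
    and S: "S \<in> carrier_mat n k" and D: "D \<in> carrier_mat n m"
    and S': "S' \<in> carrier_mat k n" and D': "D' \<in> carrier_mat m n"
    and S'S: "S' * S = 1\<^sub>m k" and S'D: "S' * D = 0\<^sub>m k m"
    and D'S: "D' * S = 0\<^sub>m m k" and D'D: "D' * D = 1\<^sub>m m"
  shows "det B * det (S' * C * S) = det (D' * B * D)"
proof -
  \<comment> \<open>Rows and columns are juxtaposed by means of block matrices with empty blocks.\<close>
  define V where "V = four_block_mat S' (0\<^sub>m k 0) D' (0\<^sub>m m 0)"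
  define W where "W = four_block_mat (C * S) D (0\<^sub>m 0 k) (0\<^sub>m 0 m)"
  have CS: "C * S \<in> carrier_mat n k" and BD: "B * D \<in> carrier_mat n m"
    using B C S D by auto
  have V: "V \<in> carrier_mat n n"
    unfolding V_def n using S' D' n by (intro carrier_matI) auto
  have W: "W \<in> carrier_mat n n"
    unfolding W_def n using CS D n by (intro carrier_matI) auto
  have z: "0\<^sub>m r 0 * 0\<^sub>m 0 c = (0\<^sub>m r c :: 'a mat)" for r c
    by (rule left_mult_zero_mat[OF zero_carrier_mat])
  have BCS: "B * (C * S) = S"
    using assoc_mult_mat[OF B C S] BC S by simp
  have "B = four_block_mat B (0\<^sub>m n 0) (0\<^sub>m 0 n) (0\<^sub>m 0 0)"
    using B by (intro eq_matI) auto
  then have "B * W = four_block_mat B (0\<^sub>m n 0) (0\<^sub>m 0 n) (0\<^sub>m 0 0) * W"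
    by simp
  also have "\<dots> = four_block_mat (B * (C * S) + 0\<^sub>m n 0 * 0\<^sub>m 0 k) (B * D + 0\<^sub>m n 0 * 0\<^sub>m 0 m)
      (0\<^sub>m 0 n * (C * S) + 0\<^sub>m 0 0 * 0\<^sub>m 0 k) (0\<^sub>m 0 n * D + 0\<^sub>m 0 0 * 0\<^sub>m 0 m)"
    unfolding W_def by (rule mult_four_block_mat[OF B _ _ _ CS D]) auto
  also have "\<dots> = four_block_mat S (B * D) (0\<^sub>m 0 k) (0\<^sub>m 0 m)"
    unfolding BCS z left_mult_zero_mat[OF CS] left_mult_zero_mat[OF D]
    using S BD by simp
  finally have BW: "B * W = four_block_mat S (B * D) (0\<^sub>m 0 k) (0\<^sub>m 0 m)" .
  \<comment> \<open>One computation serves both \<open>W\<close> and \<open>B * W\<close>, since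
    each juxtaposes a block of \<open>k\<close> columns and a block of \<open>m\<close>
    columns.\<close>
  have VX: "V * four_block_mat X Y (0\<^sub>m 0 k) (0\<^sub>m 0 m) =
      four_block_mat (S' * X) (S' * Y) (D' * X) (D' * Y)"
    if X: "X \<in> carrier_mat n k" and Y: "Y \<in> carrier_mat n m" for X Y
  proof -
    have "V * four_block_mat X Y (0\<^sub>m 0 k) (0\<^sub>m 0 m) =
        four_block_mat (S' * X + 0\<^sub>m k 0 * 0\<^sub>m 0 k) (S' * Y + 0\<^sub>m k 0 * 0\<^sub>m 0 m)
          (D' * X + 0\<^sub>m m 0 * 0\<^sub>m 0 k) (D' * Y + 0\<^sub>m m 0 * 0\<^sub>m 0 m)"
      unfolding V_def by (rule mult_four_block_mat[OF S' _ D' _ X Y]) auto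
    also have "\<dots> = four_block_mat (S' * X) (S' * Y) (D' * X) (D' * Y)"
      unfolding z using mult_carrier_mat[OF S' X] mult_carrier_mat[OF S' Y]
        mult_carrier_mat[OF D' X] mult_carrier_mat[OF D' Y] by simp
    finally show ?thesis .
  qed
  have "V * W = four_block_mat (S' * (C * S)) (0\<^sub>m k m) (D' * (C * S)) (1\<^sub>m m)"
    unfolding W_def VX[OF CS D] S'D D'D ..
  then have 1: "det (V * W) = det (S' * (C * S))"
    using S' D' CS by (simp add: det_four_block_mat_upper_right_zero[where n = k and m = m])
  have "V * (B * W) = four_block_mat (1\<^sub>m k) (S' * (B * D)) (0\<^sub>m m k) (D' * (B * D))"
    unfolding BW VX[OF S BD] S'S D'S ..
  then have 2: "det (V * (B * W)) = det (D' * (B * D))"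
    using S' D' BD by (simp add: det_four_block_mat_lower_left_zero[where n = k and m = m])
  \<comment> \<open>Both sides equal \<open>det V * det B * det W\<close>, so nothing has to be
    cancelled.\<close>
  have "det B * det (V * W) = det (V * (B * W))"
    using det_mult[OF V W] det_mult[OF V mult_carrier_mat[OF B W]] det_mult[OF B W] by simp
  then show ?thesis
    using 1 2 assoc_mult_mat[OF S' C S] assoc_mult_mat[OF D' B D] by simp
qed

section \<open>Inverses, determinants and constant matrices over rational functions\<close>

lemma inv_mat_nonsingular:
  fixes M :: "'a :: field mat"
  assumes M: "M \<in> carrier_mat n n" and "det M \<noteq> 0"
  shows "inv_mat M \<in> carrier_mat n n" "M * inv_mat M = 1\<^sub>m n"
proof -
  \<comment> \<open>The argument \<open>()\<close> fills the extension slot of the matrix ring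
    record, so that both facts speak of the units of the same ring.\<close>
  obtain N where "mat_inverse M = Some N"
    using mat_inverse(1)[OF M, of "()"] det_non_zero_imp_unit[OF M \<open>det M \<noteq> 0\<close>, of "()"]
    by (cases "mat_inverse M") auto
  then show "inv_mat M \<in> carrier_mat n n" "M * inv_mat M = 1\<^sub>m n"
    using mat_inverse(2)[OF M] by auto
qed

lemma det_inv_mat:
  fixes M :: "'a :: field mat"
  assumes M: "M \<in> carrier_mat n n" and "det M \<noteq> 0"
  shows "det (inv_mat M) = 1 / det M"
  using det_mult[OF M inv_mat_nonsingular(1)[OF assms]] inv_mat_nonsingular(2)[OF assms] assms
  by (simp add: field_simps)

text \<open>The embedding \<open>to_fract\<close> is a ring homomorphism and so commutes with
  determinants. Nonvanishing of both determinants on the right of the theorem then follows from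
  monicity of characteristic polynomials.\<close>

lemma det_ratfun_char:
  assumes "A \<in> carrier_mat n n"
  shows "det (ratfun_var \<cdot>\<^sub>m 1\<^sub>m n - ratfun_mat A) = to_fract (char_poly A)"
proof -
  have "ratfun_var \<cdot>\<^sub>m 1\<^sub>m n - ratfun_mat A = map_mat to_fract (char_poly_matrix A)"
    using assms unfolding ratfun_var_def ratfun_mat_def char_poly_matrix_def
    by (intro eq_matI) (auto simp flip: to_fract_diff to_fract_uminus)
  then show ?thesis
    by (simp add: char_poly_def)
qed

lemma char_poly_nonzero:
  assumes "A \<in> carrier_mat n n"
  shows "char_poly A \<noteq> 0"
  using degree_monic_char_poly[OF assms] by auto

lemma ratfun_mat_carrier [simp]: "ratfun_mat M \<in> carrier_mat r c \<longleftrightarrow> M \<in> carrier_mat r c"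
  by (simp add: ratfun_mat_def)

lemma ratfun_mat_mult:
  assumes "M \<in> carrier_mat r n" "N \<in> carrier_mat n c"
  shows "ratfun_mat (M * N) = ratfun_mat M * ratfun_mat N"
proof -
  interpret h: semiring_hom "\<lambda>a :: complex. to_fract [:a:]"
    by unfold_locales (auto simp flip: to_fract_add to_fract_mult simp: one_pCons[symmetric])
  show ?thesis
    unfolding ratfun_mat_def by (rule h.mat_hom_mult[OF assms])
qed

lemma ratfun_mat_one [simp]: "ratfun_mat (1\<^sub>m n) = 1\<^sub>m n"
  by (rule eq_matI) (auto simp: ratfun_mat_def simp flip: one_pCons)

lemma ratfun_mat_zero [simp]: "ratfun_mat (0\<^sub>m r c) = 0\<^sub>m r c"
  by (rule eq_matI) (auto simp: ratfun_mat_def)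

section \<open>Adjoints, Hermitian products and traces\<close>

lemma mat_adjoint_carrier:
  "M \<in> carrier_mat r c \<Longrightarrow> mat_adjoint M \<in> carrier_mat c r"
  by (auto simp: mat_adjoint_def)

lemma dim_mat_adjoint [simp]:
  "dim_row (mat_adjoint M) = dim_col M" "dim_col (mat_adjoint M) = dim_row M"
  by (simp_all add: mat_adjoint_def)

lemma mat_adjoint_mult_vec_index:
  fixes M :: "complex mat"
  assumes "M \<in> carrier_mat n k" "v \<in> carrier_vec n" "i < k"
  shows "(mat_adjoint M *\<^sub>v v) $ i = v \<bullet>c col M i"
  using assms by (auto simp: mat_adjoint_def intro!: comm_scalar_prod[of _ n])

lemma mat_adjoint_mult_index:
  fixes M N :: "complex mat"
  assumes M: "M \<in> carrier_mat n k" and N: "N \<in> carrier_mat n m" and "i < k" "j < m"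
  shows "(mat_adjoint M * N) $$ (i, j) = col N j \<bullet>c col M i"
  using assms by (auto simp: mat_adjoint_def intro!: comm_scalar_prod[of _ n])

text \<open>Adjointness, by interchanging two finite sums. It turns vanishing under
  \<open>mat_adjoint M\<close> into orthogonality to the column space of \<open>M\<close>.\<close>

lemma cscalar_prod_mat_mult:
  fixes M :: "complex mat"
  assumes M: "M \<in> carrier_mat n k" and u: "u \<in> carrier_vec n" and x: "x \<in> carrier_vec k"
  shows "u \<bullet>c (M *\<^sub>v x) = (mat_adjoint M *\<^sub>v u) \<bullet>c x"
proof -
  have "u \<bullet>c (M *\<^sub>v x) = (\<Sum>i<n. \<Sum>j<k. u $ i * cnj (M $$ (i, j)) * cnj (x $ j))"
    using assms by (auto simp: scalar_prod_def sum_distrib_left atLeast0LessThan ac_simps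
        intro!: sum.cong)
  also have "\<dots> = (\<Sum>j<k. \<Sum>i<n. u $ i * cnj (M $$ (i, j)) * cnj (x $ j))"
    by (rule sum.swap)
  also have "\<dots> = (\<Sum>j<k. (u \<bullet>c col M j) * cnj (x $ j))"
    using assms by (auto simp: scalar_prod_def sum_distrib_right atLeast0LessThan
        intro!: sum.cong)
  also have "\<dots> = (mat_adjoint M *\<^sub>v u) \<bullet>c x"
    using assms mat_adjoint_carrier[OF M] mat_adjoint_mult_vec_index[OF M u]
    by (auto simp: scalar_prod_def[of "mat_adjoint M *\<^sub>v u"] atLeast0LessThan
        simp del: index_mult_mat_vec intro!: sum.cong)
  finally show ?thesis .
qed

lemma orthonormal_cols_adjoint_mult:
  assumes "orthonormal_cols M" "M \<in> carrier_mat n k"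
  shows "mat_adjoint M * M = 1\<^sub>m k"
proof (rule eq_matI)
  fix i j assume "i < dim_row (1\<^sub>m k :: complex mat)" "j < dim_col (1\<^sub>m k :: complex mat)"
  then show "(mat_adjoint M * M) $$ (i, j) = 1\<^sub>m k $$ (i, j)"
    using assms mat_adjoint_mult_index[OF assms(2) assms(2), of i j]
    by (auto simp: orthonormal_cols_def simp del: index_mult_mat)
qed (use assms(2) in auto)

text \<open>Cyclicity of the trace for rectangular factors, needed to compute the traces of the two
  orthogonal projections.\<close>

lemma sum_diagonal_mult_commute:
  fixes M N :: "'a :: comm_semiring_0 mat"
  assumes "M \<in> carrier_mat r c" "N \<in> carrier_mat c r"
  shows "(\<Sum>i<r. (M * N) $$ (i, i)) = (\<Sum>j<c. (N * M) $$ (j, j))"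
proof -
  have "(\<Sum>i<r. (M * N) $$ (i, i)) = (\<Sum>i<r. \<Sum>j<c. M $$ (i, j) * N $$ (j, i))"
    using assms by (auto simp: scalar_prod_def atLeast0LessThan intro!: sum.cong)
  also have "\<dots> = (\<Sum>j<c. \<Sum>i<r. M $$ (i, j) * N $$ (j, i))"
    by (rule sum.swap)
  also have "\<dots> = (\<Sum>j<c. (N * M) $$ (j, j))"
    using assms by (auto simp: scalar_prod_def atLeast0LessThan ac_simps intro!: sum.cong)
  finally show ?thesis .
qed

lemma col_in_col_space:
  assumes "M \<in> carrier_mat n k" "i < k"
  shows "col M i \<in> vec_space.col_space n (M :: complex mat)"
  unfolding vec_space.col_space_eq[OF assms(1)]
  using assms by (auto intro!: bexI[of _ "unit_vec k i"] intro!: eq_vecI)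

section \<open>The orthogonal complement of a column space\<close>

context
  fixes S D :: "complex mat" and n k m :: nat
  assumes S: "S \<in> carrier_mat n k" and D: "D \<in> carrier_mat n m"
    and orthS: "orthonormal_cols S"
    and basisD: "orthonormal_basis_cols n D (hermitian_complement n (vec_space.col_space n S))"
begin

lemma col_space_eq_complement:
  "vec_space.col_space n D = hermitian_complement n (vec_space.col_space n S)"
  using basisD by (simp add: orthonormal_basis_cols_def)

lemma cols_complement_orthogonal:
  assumes "i < k" "j < m"
  shows "col D j \<bullet>c col S i = 0"
  using col_in_col_space[OF D \<open>j < m\<close>] col_in_col_space[OF S \<open>i < k\<close>]
  unfolding col_space_eq_complement hermitian_complement_def by auto

lemma adjoint_mult_complement:
  "mat_adjoint S * D = 0\<^sub>m k m"
proof (rule eq_matI)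
  fix i j assume "i < dim_row (0\<^sub>m k m :: complex mat)" "j < dim_col (0\<^sub>m k m :: complex mat)"
  then show "(mat_adjoint S * D) $$ (i, j) = 0\<^sub>m k m $$ (i, j)"
    using mat_adjoint_mult_index[OF S D, of i j] cols_complement_orthogonal
    by (auto simp del: index_mult_mat)
qed (use S D in auto)

lemma complement_adjoint_mult:
  "mat_adjoint D * S = 0\<^sub>m m k"
proof (rule eq_matI)
  fix i j assume "i < dim_row (0\<^sub>m m k :: complex mat)" "j < dim_col (0\<^sub>m m k :: complex mat)"
  then have ij: "i < m" "j < k" by auto
  \<comment> \<open>Hermitian symmetry transfers the orthogonality already known for the opposite
    order of the arguments.\<close>
  have "col S j \<bullet>c col D i = conjugate (col D i \<bullet>c col S j)"
    using S D ij conjugate_conjugate_sprod[of "col D i" n "col S j"]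
      conjugate_vec_sprod_comm[of "col S j" n "col D i"]
    by (metis col_carrier_vec carrier_matD(2) complex_cnj_cnj conjugate_complex_def)
  then show "(mat_adjoint D * S) $$ (i, j) = 0\<^sub>m m k $$ (i, j)"
    using mat_adjoint_mult_index[OF D S ij] cols_complement_orthogonal[OF ij(2,1)] ij
    by (auto simp del: index_mult_mat)
qed (use S D in auto)

text \<open>The columns of the left side \<open>R\<close> lie in the complement, so
  \<open>R = D * X\<close> for some \<open>X\<close>, and multiplying by
  \<open>mat_adjoint D\<close> identifies \<open>X\<close>. Here it matters that the columns of
  \<open>D\<close> span the whole complement, beyond being orthogonal to those of
  \<open>S\<close>.\<close>

lemma projections_sum:
  "1\<^sub>m n - S * mat_adjoint S = D * mat_adjoint D"
proof -
  note S' = mat_adjoint_carrier[OF S] and D' = mat_adjoint_carrier[OF D]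
  define R where "R = 1\<^sub>m n - S * mat_adjoint S"
  have R: "R \<in> carrier_mat n n"
    unfolding R_def using S by (intro carrier_matI) auto
  have "mat_adjoint S * R = mat_adjoint S - mat_adjoint S * (S * mat_adjoint S)"
    unfolding R_def
    using mult_minus_distrib_mat[OF S' one_carrier_mat mult_carrier_mat[OF S S']]
      right_mult_one_mat[OF S'] by simp
  also have "mat_adjoint S * (S * mat_adjoint S) = mat_adjoint S"
    using assoc_mult_mat[OF S' S S'] orthonormal_cols_adjoint_mult[OF orthS S]
      left_mult_one_mat[OF S'] by simp
  finally have S'R: "mat_adjoint S * R = 0\<^sub>m k n"
    using S by (auto intro!: eq_matI)
  have D'R: "mat_adjoint D * R = mat_adjoint D"
  proof -
    have "mat_adjoint D * R = mat_adjoint D - mat_adjoint D * (S * mat_adjoint S)"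
      unfolding R_def
      using mult_minus_distrib_mat[OF D' one_carrier_mat mult_carrier_mat[OF S S']]
        right_mult_one_mat[OF D'] by simp
    also have "mat_adjoint D * (S * mat_adjoint S) = 0\<^sub>m m n"
      using assoc_mult_mat[OF D' S S'] complement_adjoint_mult left_mult_zero_mat[OF S'] by simp
    finally show ?thesis
      using D by (auto intro!: eq_matI)
  qed
  \<comment> \<open>A column of \<open>R\<close> is killed by \<open>mat_adjoint S\<close>, hence by
    adjointness orthogonal to every \<open>S *\<^sub>v x\<close>; spanning then supplies its
    coordinates with respect to \<open>D\<close>.\<close>
  have "\<exists>x \<in> carrier_vec m. D *\<^sub>v x = col R j" if "j < n" for j
  proof -
    have "mat_adjoint S *\<^sub>v col R j = 0\<^sub>v k"
      using col_mult2[OF S' R that] S'R that by (auto intro!: eq_vecI)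
    then have "col R j \<bullet>c (S *\<^sub>v x) = 0" if "x \<in> carrier_vec k" for x
      using cscalar_prod_mat_mult[OF S _ that, of "col R j"] R \<open>j < n\<close> that by auto
    then have "col R j \<in> hermitian_complement n (vec_space.col_space n S)"
      using R S \<open>j < n\<close>
      by (auto simp: hermitian_complement_def vec_space.col_space_eq[OF S])
    then show ?thesis
      using D by (simp flip: col_space_eq_complement add: vec_space.col_space_eq[OF D])
  qed
  then obtain x where x: "\<And>j. j < n \<Longrightarrow> x j \<in> carrier_vec m \<and> D *\<^sub>v x j = col R j"
    by metis
  define X where "X = mat m n (\<lambda>(i, j). x j $ i)"
  have X: "X \<in> carrier_mat m n"
    by (simp add: X_def)
  have "R = D * X"
  proof (rule mat_col_eqI)
    fix j assume "j < dim_col (D * X)"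
    then have j: "j < n" using X by simp
    then have "col X j = x j"
      using x[OF j] by (auto simp: X_def intro!: eq_vecI)
    then show "col R j = col (D * X) j"
      using x[OF j] col_mult2[OF D X j] by simp
  qed (use R D X in auto)
  \<comment> \<open>Since \<open>mat_adjoint D * D\<close> is the identity, \<open>X\<close> equals
    \<open>mat_adjoint D * R\<close>, which is \<open>mat_adjoint D\<close> by
    \<open>D'R\<close>.\<close>
  moreover have "X = mat_adjoint D"
    using assoc_mult_mat[OF D' D X] D'R \<open>R = D * X\<close> X
      orthonormal_cols_adjoint_mult[OF _ D] basisD
    by (simp add: orthonormal_basis_cols_def)
  ultimately show ?thesis
    by (simp add: R_def)
qed

lemma dim_add_complement: "n = k + m"
proof -
  note S' = mat_adjoint_carrier[OF S] and D' = mat_adjoint_carrier[OF D]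
  have D'D: "mat_adjoint D * D = 1\<^sub>m m"
    using orthonormal_cols_adjoint_mult[OF _ D] basisD by (simp add: orthonormal_basis_cols_def)
  have entry: "1 - (S * mat_adjoint S) $$ (i, i) = (D * mat_adjoint D) $$ (i, i)" if "i < n" for i
    using arg_cong[OF projections_sum, of "\<lambda>M. M $$ (i, i)"] that S by (simp del: index_mult_mat(1))
  have "of_nat n - (\<Sum>i<n. (S * mat_adjoint S) $$ (i, i)) =
      (\<Sum>i<n. 1 - (S * mat_adjoint S) $$ (i, i))"
    by (simp add: sum_subtractf)
  also have "\<dots> = (\<Sum>i<n. (D * mat_adjoint D) $$ (i, i))"
    using entry by (intro sum.cong) auto
  finally have "of_nat n - (\<Sum>i<n. (S * mat_adjoint S) $$ (i, i)) =
      (\<Sum>i<n. (D * mat_adjoint D) $$ (i, i))" .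
  \<comment> \<open>By cyclicity the two projections have the traces of identity matrices of sizes
    \<open>k\<close> and \<open>m\<close>. The count takes place in the complex numbers and descends
    to naturals because the characteristic is zero.\<close>
  then have "of_nat n - of_nat k = (of_nat m :: complex)"
    using sum_diagonal_mult_commute[OF S S'] sum_diagonal_mult_commute[OF D D']
      orthonormal_cols_adjoint_mult[OF orthS S] D'D by simp
  then have "of_nat n = (of_nat (k + m) :: complex)"
    by (simp add: diff_eq_eq)
  then show ?thesis
    using of_nat_eq_iff by blast
qed

end

section \<open>The determinant formula over the field of rational functions\<close>

theorem theorem2p18:
  fixes A \<Sigma> \<Delta> :: "complex mat" and n k m :: nat
  assumes "A \<in> carrier_mat n n"
    and "\<Sigma> \<in> carrier_mat n k"
    and "orthonormal_cols \<Sigma>"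
    and "\<Delta> \<in> carrier_mat n m"
    and "orthonormal_basis_cols n \<Delta>
           (hermitian_complement n (vec_space.col_space n \<Sigma>))"
  shows "det (ratfun_var \<cdot>\<^sub>m 1\<^sub>m k - isospectral_reduction \<Sigma> A) =
         det (ratfun_var \<cdot>\<^sub>m 1\<^sub>m n - ratfun_mat A) /
         det (ratfun_var \<cdot>\<^sub>m 1\<^sub>m m - ratfun_mat (mat_adjoint \<Delta> * A * \<Delta>))"
proof -
  note A = assms(1) and S = assms(2) and D = assms(4)
  note S' = mat_adjoint_carrier[OF S] and D' = mat_adjoint_carrier[OF D]
  note ctx = S D assms(3) assms(5)
  define B where "B = ratfun_var \<cdot>\<^sub>m 1\<^sub>m n - ratfun_mat A"
  define M where "M = ratfun_mat (mat_adjoint \<Sigma>) * inv_mat B * ratfun_mat \<Sigma>"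
  have B: "B \<in> carrier_mat n n"
    unfolding B_def using A by (simp add: minus_carrier_mat)
  have detB: "det B \<noteq> 0"
    unfolding B_def det_ratfun_char[OF A] using char_poly_nonzero[OF A] by simp
  note C = inv_mat_nonsingular[OF B detB]
  have D'D: "mat_adjoint \<Delta> * \<Delta> = 1\<^sub>m m"
    using orthonormal_cols_adjoint_mult[OF _ D] assms(5)
    by (simp add: orthonormal_basis_cols_def)
  have key: "det B * det M = det (ratfun_mat (mat_adjoint \<Delta>) * B * ratfun_mat \<Delta>)"
    unfolding M_def
  proof (rule det_compress_inverse[OF dim_add_complement[OF ctx] B C])
    show "ratfun_mat (mat_adjoint \<Sigma>) * ratfun_mat \<Sigma> = 1\<^sub>m k"
      using ratfun_mat_mult[OF S' S] orthonormal_cols_adjoint_mult[OF assms(3) S] by simp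
    show "ratfun_mat (mat_adjoint \<Sigma>) * ratfun_mat \<Delta> = 0\<^sub>m k m"
      using ratfun_mat_mult[OF S' D] adjoint_mult_complement[OF ctx] by simp
    show "ratfun_mat (mat_adjoint \<Delta>) * ratfun_mat \<Sigma> = 0\<^sub>m m k"
      using ratfun_mat_mult[OF D' S] complement_adjoint_mult[OF ctx] by simp
    show "ratfun_mat (mat_adjoint \<Delta>) * ratfun_mat \<Delta> = 1\<^sub>m m"
      using ratfun_mat_mult[OF D' D] D'D by simp
  qed (use S D in auto)
  \<comment> \<open>Orthonormality of the columns of \<open>\<Delta>\<close> is what sends the
    scalar part of \<open>B\<close> to the scalar matrix of size \<open>m\<close>.\<close>
  have compress: "ratfun_mat (mat_adjoint \<Delta>) * B * ratfun_mat \<Delta> =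
      ratfun_var \<cdot>\<^sub>m 1\<^sub>m m - ratfun_mat (mat_adjoint \<Delta> * A * \<Delta>)"
  proof -
    let ?D = "ratfun_mat \<Delta>" and ?D' = "ratfun_mat (mat_adjoint \<Delta>)" and ?A = "ratfun_mat A"
    have c: "?D \<in> carrier_mat n m" "?D' \<in> carrier_mat m n" "?A \<in> carrier_mat n n"
      using A D D' by auto
    have "?D' * B = ratfun_var \<cdot>\<^sub>m ?D' - ?D' * ?A"
      unfolding B_def using c
      by (subst mult_minus_distrib_mat[OF c(2) _ c(3)]) (auto simp: mult_smult_distrib[OF c(2) one_carrier_mat] simp del: ratfun_mat_carrier)
    then have "?D' * B * ?D = ratfun_var \<cdot>\<^sub>m (?D' * ?D) - ?D' * ?A * ?D"
      using c by (simp add: minus_mult_distrib_mat[of _ m n] mult_smult_assoc_mat)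
    then show ?thesis
      using A D D' D'D ratfun_mat_mult[OF D' D]
        ratfun_mat_mult[OF D' A] ratfun_mat_mult[OF mult_carrier_mat[OF D' A] D] by simp
  qed
  have M: "M \<in> carrier_mat k k"
    unfolding M_def using S S' C(1) by auto
  define E where "E = det (ratfun_var \<cdot>\<^sub>m 1\<^sub>m m - ratfun_mat (mat_adjoint \<Delta> * A * \<Delta>))"
  have D'AD: "mat_adjoint \<Delta> * A * \<Delta> \<in> carrier_mat m m"
    using A D D' by auto
  have "E \<noteq> 0"
    unfolding E_def det_ratfun_char[OF D'AD] using char_poly_nonzero[OF D'AD] by simp
  have eq: "det B * det M = E"
    using key compress by (simp add: E_def)
  \<comment> \<open>This makes the outer inverse in \<open>isospectral_reduction\<close> a genuine
    inverse instead of an unspecified value.\<close>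
  then have detM: "det M \<noteq> 0"
    using \<open>E \<noteq> 0\<close> by auto
  note N = inv_mat_nonsingular[OF M detM]
  have "isospectral_reduction \<Sigma> A = ratfun_var \<cdot>\<^sub>m 1\<^sub>m k - inv_mat M"
    using A S by (simp add: isospectral_reduction_def M_def B_def)
  \<comment> \<open>The scalar terms cancel, so the matrix on the left of the theorem is the inverse
    of \<open>M\<close>.\<close>
  moreover have "ratfun_var \<cdot>\<^sub>m 1\<^sub>m k - (ratfun_var \<cdot>\<^sub>m 1\<^sub>m k - inv_mat M) = inv_mat M"
    using N(1) by (intro eq_matI) auto
  ultimately have "det (ratfun_var \<cdot>\<^sub>m 1\<^sub>m k - isospectral_reduction \<Sigma> A) = 1 / det M"
    using det_inv_mat[OF M detM] by simp
  also have "\<dots> = det B / E"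
    using eq detM \<open>E \<noteq> 0\<close> by (simp add: field_simps)
  finally show ?thesis
    by (simp add: B_def E_def)
qed

end
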